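(* Let $D$ be a Dedekind domain with infinitely many maximal ideals, all of them of finite index, and let $K$ be its quotient field. Then for every $n\ge 1$ there exist elements $H,G_1,\ldots,G_{n+1}$ of $\operatorname{Int}(D)$, each irreducible in $\operatorname{Int}(D)$, such that \[x\,H(x)=G_1(x)\cdots G_{n+1}(x).\]
   Context: $\operatorname{Int}(D)=\{f\in K[x]\mid f(D)\subseteq D\}$ is the ring of integer-valued polynomials on $D$. An element is irreducible if it is a non-zero non-unit that cannot be written as a product of two non-units. *)

theory Defs
  imports "HOL-Computational_Algebra.Polynomial_Factorial"
begin

definition is_ideal :: "'a::comm_ring_1 set \<Rightarrow> bool" where
  "is_ideal I \<longleftrightarrow> 0 \<in> I \<and> (\<forall>x\<in>I. \<forall>y\<in>I. x + y \<in> I) \<and> (\<forall>r. \<forall>x\<in>I. r * x \<in> I)"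

definition is_prime_ideal :: "'a::comm_ring_1 set \<Rightarrow> bool" where
  "is_prime_ideal P \<longleftrightarrow> is_ideal P \<and> P \<noteq> UNIV \<and> (\<forall>x y. x * y \<in> P \<longrightarrow> x \<in> P \<or> y \<in> P)"

definition is_maximal_ideal :: "'a::comm_ring_1 set \<Rightarrow> bool" where
  "is_maximal_ideal M \<longleftrightarrow> is_ideal M \<and> M \<noteq> UNIV \<and>
     (\<forall>J. is_ideal J \<and> M \<subseteq> J \<longrightarrow> J = M \<or> J = UNIV)"

definition finite_index :: "'a::comm_ring_1 set \<Rightarrow> bool" where
  "finite_index M \<longleftrightarrow> finite ((\<lambda>a. (+) a ` M) ` UNIV)"

definition noetherian_ring :: "'a::comm_ring_1 itself \<Rightarrow> bool" where
  "noetherian_ring _ \<longleftrightarrow> (\<forall>I :: nat \<Rightarrow> 'a set. (\<forall>n. is_ideal (I n)) \<and> (\<forall>n. I n \<subseteq> I (Suc n))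
      \<longrightarrow> (\<exists>N. \<forall>n\<ge>N. I n = I N))"

definition integrally_closed :: "'a::idom itself \<Rightarrow> bool" where
  "integrally_closed _ \<longleftrightarrow> (\<forall>x :: 'a fract. \<forall>p :: 'a poly.
      lead_coeff p = 1 \<and> poly (map_poly to_fract p) x = 0 \<longrightarrow> x \<in> range to_fract)"

definition dedekind_domain :: "'a::idom itself \<Rightarrow> bool" where
  "dedekind_domain T \<longleftrightarrow> noetherian_ring T \<and> integrally_closed T \<and>
      (\<forall>P :: 'a set. is_prime_ideal P \<and> P \<noteq> {0} \<longrightarrow> is_maximal_ideal P)"

definition IntD :: "'a::idom fract poly set" where
  "IntD = {f. \<forall>d :: 'a. poly f (to_fract d) \<in> range to_fract}"

definition IntD_unit :: "'a::idom fract poly \<Rightarrow> bool" where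
  "IntD_unit f \<longleftrightarrow> f \<in> IntD \<and> (\<exists>g \<in> IntD. f * g = 1)"

definition IntD_irreducible :: "'a::idom fract poly \<Rightarrow> bool" where
  "IntD_irreducible f \<longleftrightarrow> f \<in> IntD \<and> f \<noteq> 0 \<and> \<not> IntD_unit f \<and>
     (\<forall>g \<in> IntD. \<forall>h \<in> IntD. f = g * h \<longrightarrow> IntD_unit g \<or> IntD_unit h)"

end

theory Submission
  imports Defs
begin

text \<open>
  Let \<open>P\<^sub>1, \<dots>, P\<^sub>n\<close> and \<open>R\<close> be distinct maximal ideals. Choose \<open>c\<close> of valuation one at every
  \<open>P\<^sub>i\<close> and prime to \<open>R\<close>, and \<open>e\<close> of valuation one at \<open>R\<close>, outside every \<open>P\<^sub>i\<close>, and with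
  \<open>e (P\<^sub>1 \<inter> \<dots> \<inter> P\<^sub>n) \<subseteq> (c)\<close>. Let \<open>m\<close> be a common exponent of the unit groups of the residue
  fields \<open>D / P\<^sub>i\<close>, and let \<open>b\<^sub>i\<close> lie in \<open>P\<^sub>i\<close> but in no other \<open>P\<^sub>j\<close>. Put
  \<open>f = e + (c - e) x\<^sup>m\<close> and \<open>L\<^sub>i = b\<^sub>i + (1 - b\<^sub>i) x\<close>; then
  \<open>H = f L\<^sub>1 \<cdots> L\<^sub>n / c\<close>, \<open>G\<^sub>1 = x f / c\<close> and \<open>G\<^sub>i\<^sub>+\<^sub>1 = L\<^sub>i\<close> do the job.

  The polynomial \<open>f\<close> is irreducible over the fraction field by Eisenstein's criterion at \<open>R\<close>.
  It covers all nonzero residues modulo \<open>P\<^sub>i\<close>, while the residue \<open>0\<close> is covered by \<open>x\<close> in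
  \<open>G\<^sub>1\<close> and by \<open>L\<^sub>i\<close> alone in \<open>H\<close>. So in a factorization of \<open>H\<close> or \<open>G\<^sub>1\<close> no linear
  factor can be separated from \<open>f\<close>: evaluate one factor at \<open>0\<close> and the other one at \<open>1\<close>. The
  values \<open>f(1) = c\<close> and \<open>L\<^sub>i(1) = 1\<close> exclude constant nonunit factors.
\<close>

section \<open>Polynomials over a field\<close>

text \<open>Irreducibles over a field are prime, so induction on \<open>S\<close> cancels one
  \<open>p x\<close> from \<open>g\<close> or from \<open>h\<close>. The scalars \<open>k1\<close>,
  \<open>k2\<close> are recorded because nonzero constants of the fraction field need not be units
  of \<open>IntD\<close>.\<close>

lemma prod_irreducible_factors:
  fixes p :: "'i \<Rightarrow> 'k::field poly"
  assumes "finite S" and "\<And>i. i \<in> S \<Longrightarrow> irreducible (p i)"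
    and "g * h = smult k (\<Prod>i\<in>S. p i)" and "k \<noteq> 0"
  shows "\<exists>T k1 k2. T \<subseteq> S \<and> k1 * k2 = k \<and>
           g = smult k1 (\<Prod>i\<in>T. p i) \<and> h = smult k2 (\<Prod>i\<in>S - T. p i)"
  using assms
proof (induction S arbitrary: g h rule: finite_induct)
  case empty
  then have gh: "g * h = [:k:]" by simp
  with \<open>k \<noteq> 0\<close> have ne: "g \<noteq> 0" "h \<noteq> 0" by auto
  then have "degree g + degree h = 0"
    using gh by (metis degree_mult_eq degree_pCons_0)
  then obtain k1 k2 where "g = [:k1:]" "h = [:k2:]"
    by (metis add_is_0 degree_0_id)
  with gh show ?case by (intro exI[of _ "{}"] exI[of _ k1] exI[of _ k2]) auto
next
  case (insert x S)
  have px: "prime_elem (p x)"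
    using insert.prems(1) field_poly_irreducible_imp_prime by blast
  then have px0: "p x \<noteq> 0" by auto
  have eq: "g * h = p x * smult k (\<Prod>i\<in>S. p i)"
    using insert.prems(2) insert.hyps by simp
  then have "p x dvd g * h" by (metis dvd_triv_left)
  then have "p x dvd g \<or> p x dvd h" using px by (simp add: prime_elem_dvd_mult_iff)
  then show ?case
  proof
    assume "p x dvd g"
    then obtain g' where g': "g = p x * g'" by blast
    with eq px0 have "g' * h = smult k (\<Prod>i\<in>S. p i)"
      by (metis mult.assoc mult_left_cancel)
    then obtain T k1 k2 where T: "T \<subseteq> S" "k1 * k2 = k" "g' = smult k1 (\<Prod>i\<in>T. p i)"
        "h = smult k2 (\<Prod>i\<in>S - T. p i)"
      using insert.IH[of g' h] insert.prems by blast
    have "finite T" "x \<notin> T" "insert x S - insert x T = S - T"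
      using T(1) insert.hyps finite_subset by auto
    with T g' have "insert x T \<subseteq> insert x S" "g = smult k1 (\<Prod>i\<in>insert x T. p i)"
        "h = smult k2 (\<Prod>i\<in>insert x S - insert x T. p i)"
      by auto
    with T(2) show ?thesis by blast
  next
    assume "p x dvd h"
    then obtain h' where h': "h = p x * h'" by blast
    with eq px0 have "g * h' = smult k (\<Prod>i\<in>S. p i)"
      by (metis mult.left_commute mult_left_cancel)
    then obtain T k1 k2 where T: "T \<subseteq> S" "k1 * k2 = k" "g = smult k1 (\<Prod>i\<in>T. p i)"
        "h' = smult k2 (\<Prod>i\<in>S - T. p i)"
      using insert.IH[of g h'] insert.prems by blast
    have "finite (S - T)" "x \<notin> S - T" "insert x S - T = insert x (S - T)"
      using T(1) insert.hyps by auto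
    with T h' have "T \<subseteq> insert x S" "h = smult k2 (\<Prod>i\<in>insert x S - T. p i)"
      by auto
    with T(2,3) show ?thesis by blast
  qed
qed

lemma degree_1_irreducible:
  fixes p :: "'k::field poly"
  assumes "degree p = 1"
  shows "irreducible p"
proof (rule irreducibleI)
  show "p \<noteq> 0" using assms by auto
  then show "\<not> p dvd 1" using assms by (simp add: is_unit_iff_degree)
next
  fix a b assume ab: "p = a * b"
  with assms have ne: "a \<noteq> 0" "b \<noteq> 0" by auto
  with ab assms have "degree a + degree b = 1" by (simp add: degree_mult_eq)
  then have "degree a = 0 \<or> degree b = 0" by auto
  with ne show "a dvd 1 \<or> b dvd 1" by (auto simp: is_unit_iff_degree)
qed

section \<open>Valuation rings and Eisenstein's criterion\<close>

text \<open>\<open>A\<close> is a valuation ring with maximal ideal \<open>M\<close>. The axiom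
  \<open>inverse_M\<close> stands in for a valuation v: \<open>y / x \<in> A\<close> expresses v(x)
  \<le> v(y).\<close>

locale valuation_subring =
  fixes A M :: "'k::field set"
  assumes M_subset: "M \<subseteq> A"
    and zero_M: "0 \<in> M"
    and one_A: "1 \<in> A"
    and one_M: "1 \<notin> M"
    and add_M: "x \<in> M \<Longrightarrow> y \<in> M \<Longrightarrow> x + y \<in> M"
    and mult_A: "x \<in> A \<Longrightarrow> y \<in> A \<Longrightarrow> x * y \<in> A"
    and mult_M: "x \<in> A \<Longrightarrow> y \<in> M \<Longrightarrow> x * y \<in> M"
    and inverse_M: "x \<notin> A \<Longrightarrow> inverse x \<in> M"
begin

lemma inverse_A:
  assumes "x \<notin> M"
  shows "inverse x \<in> A"
  using assms inverse_M[of "inverse x"] by auto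

lemma M_prime:
  assumes "x \<in> A" "y \<in> A" "x * y \<in> M"
  shows "x \<in> M \<or> y \<in> M"
proof (rule ccontr)
  assume "\<not> ?thesis"
  then have "x \<noteq> 0" "inverse x \<in> A" "y \<notin> M" using zero_M inverse_A by auto
  then show False using mult_M[of "inverse x" "x * y"] assms(3)
    by (simp add: mult.assoc[symmetric])
qed

lemma sum_M: "(\<And>i. i \<in> I \<Longrightarrow> f i \<in> M) \<Longrightarrow> sum f I \<in> M"
  by (induction I rule: infinite_finite_induct) (auto simp: zero_M add_M)

text \<open>If \<open>- 1\<close> were outside \<open>A\<close>, its inverse, again
  \<open>- 1\<close>, would lie in \<open>M\<close> and hence in \<open>A\<close>.\<close>

lemma uminus_M: "x \<in> M \<Longrightarrow> - x \<in> M"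
proof (cases "- 1 \<in> A")
  case True
  then show "x \<in> M \<Longrightarrow> - x \<in> M" using mult_M[of "- 1" x] by simp
next
  case False
  then show "x \<in> M \<Longrightarrow> - x \<in> M" using inverse_M[of "- 1"] M_subset by auto
qed

text \<open>\<open>x\<close> is an element of least valuation; by \<open>inverse_M\<close>, a new
  element \<open>z\<close> is dominated by the old choice or dominates it.\<close>

lemma ex_dominating:
  assumes "finite X" "\<exists>x\<in>X. x \<noteq> 0"
  shows "\<exists>x\<in>X. x \<noteq> 0 \<and> (\<forall>y\<in>X. y / x \<in> A)"
  using assms
proof (induction X rule: finite_induct)
  case (insert z X)
  show ?case
  proof (cases "\<exists>x\<in>X. x \<noteq> 0")
    case False
    with insert.prems have "z \<noteq> 0" "X \<subseteq> {0}" by auto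
    moreover from this have "y / z \<in> A" if "y \<in> insert z X" for y
      using one_A zero_M M_subset that by (cases "y = 0") auto
    ultimately show ?thesis by blast
  next
    case True
    with insert.IH obtain x where x: "x \<in> X" "x \<noteq> 0" "\<forall>y\<in>X. y / x \<in> A" by blast
    show ?thesis
    proof (cases "z / x \<in> A")
      case True
      with x show ?thesis by auto
    next
      case False
      then have xz: "x / z \<in> A" using inverse_M[of "z / x"] M_subset by auto
      have "z \<noteq> 0" using False zero_M M_subset by auto
      moreover have "y / z \<in> A" if "y \<in> X" for y
        using mult_A[OF _ xz, of "y / x"] x that by simp
      ultimately show ?thesis using one_A by auto
    qed
  qed
qed simp

text \<open>Dividing by a coefficient of least valuation turns that coefficient into 1.\<close>

lemma ex_primitive_multiple:
  assumes "g \<noteq> 0"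
  shows "\<exists>k. k \<noteq> 0 \<and> (\<forall>i. coeff (smult k g) i \<in> A) \<and> (\<exists>i. coeff (smult k g) i \<notin> M)"
proof -
  have "\<exists>x\<in>coeff g ` {..degree g}. x \<noteq> 0"
    using assms leading_coeff_0_iff by blast
  then obtain j where j: "coeff g j \<noteq> 0" "\<forall>i\<le>degree g. coeff g i / coeff g j \<in> A"
    using ex_dominating[of "coeff g ` {..degree g}"] by auto
  have "coeff (smult (inverse (coeff g j)) g) i \<in> A" for i
    using j(2) M_subset zero_M by (cases "i \<le> degree g") (auto simp: field_simps coeff_eq_0)
  moreover have "coeff (smult (inverse (coeff g j)) g) j \<notin> M"
    using j(1) one_M by simp
  ultimately show ?thesis using j(1) by (metis inverse_zero_imp_zero)
qed

text \<open>Gauss's lemma, read off at the lowest terms modulo \<open>M\<close>: in coefficient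
  \<open>i + j\<close> every product except that of the two lowest terms has a factor in
  \<open>M\<close>.\<close>

lemma coeff_mult_Least_notin_M:
  fixes g h :: "'k poly"
  assumes g: "\<And>i. coeff g i \<in> A" and h: "\<And>i. coeff h i \<in> A"
    and i: "coeff g i \<notin> M" "\<And>k. k < i \<Longrightarrow> coeff g k \<in> M"
    and j: "coeff h j \<notin> M" "\<And>k. k < j \<Longrightarrow> coeff h k \<in> M"
  shows "coeff (g * h) (i + j) \<notin> M"
proof
  assume *: "coeff (g * h) (i + j) \<in> M"
  define r where "r = (\<Sum>k\<in>{..i + j} - {i}. coeff g k * coeff h (i + j - k))"
  have "coeff (g * h) (i + j) = coeff g i * coeff h j + r"
    unfolding coeff_mult r_def by (subst sum.remove[of _ i]) auto
  moreover have "r \<in> M" unfolding r_def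
  proof (rule sum_M)
    fix k assume "k \<in> {..i + j} - {i}"
    then consider "k < i" | "i + j - k < j" by force
    then show "coeff g k * coeff h (i + j - k) \<in> M"
      using i(2) j(2) mult_M g h by cases (metis mult.commute, blast)
  qed
  ultimately have "coeff g i * coeff h j \<in> M"
    using add_M[OF * uminus_M[of r]] by simp
  then show False using M_prime g h i(1) j(1) by blast
qed

text \<open>\<open>const\<close> keeps the constant term out of the square of \<open>M\<close>. For
  primitive multiples of \<open>g\<close> and \<open>h\<close>, the lowest terms outside
  \<open>M\<close> meet in a coefficient of \<open>f\<close> outside \<open>M\<close>, which must be
  the leading one. So both sit in top degree, and both constant terms lie in
  \<open>M\<close>.\<close>

theorem Eisenstein:
  fixes f :: "'k poly"
  assumes deg: "degree f > 0"
    and lead: "lead_coeff f \<in> A" "lead_coeff f \<notin> M"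
    and low: "\<And>i. i < degree f \<Longrightarrow> coeff f i \<in> M"
    and const: "\<And>x y. x \<in> M \<Longrightarrow> y \<in> M \<Longrightarrow> coeff f 0 \<noteq> x * y"
  shows "irreducible f"
proof (rule irreducibleI)
  show "f \<noteq> 0" using deg by auto
  then show "\<not> f dvd 1" using deg by (simp add: is_unit_iff_degree)
next
  fix g h assume f: "f = g * h"
  show "g dvd 1 \<or> h dvd 1"
  proof (rule ccontr)
    assume nu: "\<not> ?thesis"
    have ne: "g \<noteq> 0" "h \<noteq> 0" using f deg by auto
    with nu have dpos: "degree g > 0" "degree h > 0" by (auto simp: is_unit_iff_degree)
    obtain k where k: "k \<noteq> 0" "\<And>i. coeff (smult k g) i \<in> A" "\<exists>i. coeff (smult k g) i \<notin> M"
      using ex_primitive_multiple[OF ne(1)] by blast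
    obtain l where l: "l \<noteq> 0" "\<And>i. coeff (smult l h) i \<in> A" "\<exists>i. coeff (smult l h) i \<notin> M"
      using ex_primitive_multiple[OF ne(2)] by blast
    define i where "i = (LEAST i. coeff (smult k g) i \<notin> M)"
    define j where "j = (LEAST i. coeff (smult l h) i \<notin> M)"
    have i: "coeff (smult k g) i \<notin> M" "\<And>m. m < i \<Longrightarrow> coeff (smult k g) m \<in> M"
      unfolding i_def using LeastI_ex[OF k(3)] not_less_Least by blast+
    have j: "coeff (smult l h) j \<notin> M" "\<And>m. m < j \<Longrightarrow> coeff (smult l h) m \<in> M"
      unfolding j_def using LeastI_ex[OF l(3)] not_less_Least by blast+
    have prod: "smult k g * smult l h = smult (k * l) f" using f by (simp add: mult.commute)
    have notM: "k * l * coeff f (i + j) \<notin> M"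
      using coeff_mult_Least_notin_M[OF k(2) l(2) i j] unfolding prod by simp
    have "k * l * lead_coeff f \<in> A"
    proof -
      have "k * l * lead_coeff f = coeff (smult k g) (degree g) * coeff (smult l h) (degree h)"
        using f by (simp add: lead_coeff_mult)
      then show ?thesis using mult_A k(2) l(2) by metis
    qed
    \<comment> \<open>The leading coefficient of \<open>f\<close> is a unit of \<open>A\<close> and
      can be divided out.\<close>
    then have klA: "k * l \<in> A"
      using mult_A[OF _ inverse_A[OF lead(2)], of "k * l * lead_coeff f"] lead(2) zero_M
      by (cases "lead_coeff f = 0") (auto simp: mult.assoc)
    have "coeff f (i + j) \<notin> M" using notM mult_M[OF klA] by blast
    then have "i + j = degree f"
      using low zero_M by (metis coeff_eq_0 linorder_neqE_nat)
    moreover have "degree f = degree g + degree h" using f ne by (simp add: degree_mult_eq)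
    moreover have "i \<le> degree g" "j \<le> degree h"
      using i(1) j(1) zero_M le_degree by (force, force)
    ultimately have ij: "i = degree g" "j = degree h" by auto
    have "k * l \<notin> M"
      using notM mult_M[OF lead(1), of "k * l"] \<open>i + j = degree f\<close> by (auto simp: mult.commute)
    then have inv: "inverse (k * l) \<in> A" by (rule inverse_A)
    have "coeff (smult k g) 0 \<in> M" "coeff (smult l h) 0 \<in> M" using i(2) j(2) ij dpos by auto
    moreover have "coeff f 0 = (inverse (k * l) * coeff (smult k g) 0) * coeff (smult l h) 0"
      using f k(1) l(1) by (simp add: coeff_mult field_simps)
    ultimately show False using const mult_M[OF inv] by blast
  qed
qed

end

section \<open>Uniformizers at the maximal ideals of a Dedekind domain\<close>

lemma is_idealD:
  assumes "is_ideal I"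
  shows ideal_zero: "0 \<in> I"
    and ideal_add: "\<And>x y. x \<in> I \<Longrightarrow> y \<in> I \<Longrightarrow> x + y \<in> I"
    and ideal_mult_left: "\<And>r x. x \<in> I \<Longrightarrow> r * x \<in> I"
    and ideal_mult_right: "\<And>r x. x \<in> I \<Longrightarrow> x * r \<in> I"
  using assms by (auto simp: is_ideal_def mult.commute)

lemma ideal_diff:
  assumes "is_ideal I" "x \<in> I" "y \<in> I"
  shows "x - y \<in> I"
  using ideal_add[OF assms(1,2) ideal_mult_left[OF assms(1,3), of "- 1"]] by simp

lemma ideal_sum:
  assumes "is_ideal I" "\<And>i. i \<in> S \<Longrightarrow> f i \<in> I"
  shows "sum f S \<in> I"
  using assms(2)
  by (induction S rule: infinite_finite_induct) (auto simp: ideal_zero ideal_add assms(1))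

lemma ideal_eq_UNIV_iff:
  assumes "is_ideal I"
  shows "I = UNIV \<longleftrightarrow> 1 \<in> I"
  using ideal_mult_left[OF assms, of 1] by auto

lemma maximal_ideal_imp_prime:
  assumes "is_maximal_ideal M"
  shows "is_prime_ideal M"
  unfolding is_prime_ideal_def
proof (intro conjI allI impI)
  show M: "is_ideal M" and "M \<noteq> UNIV" using assms by (auto simp: is_maximal_ideal_def)
  fix x y assume xy: "x * y \<in> M"
  show "x \<in> M \<or> y \<in> M"
  proof (rule ccontr)
    assume not: "\<not> ?thesis"
    have "is_ideal {z. z * y \<in> M}"
      using ideal_zero[OF M] ideal_add[OF M] ideal_mult_left[OF M]
      by (auto simp: is_ideal_def distrib_right mult.assoc)
    moreover have "M \<subseteq> {z. z * y \<in> M}" using ideal_mult_right[OF M] by auto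
    ultimately have "{z. z * y \<in> M} = M \<or> {z. z * y \<in> M} = UNIV"
      using assms unfolding is_maximal_ideal_def by blast
    moreover have "x \<in> {z. z * y \<in> M}" "x \<notin> M" using xy not by auto
    ultimately have "1 \<in> {z. z * y \<in> M}" by blast
    then show False using not by simp
  qed
qed

lemma prime_ideal_prod_notin:
  assumes "is_prime_ideal P" "\<And>i. i \<in> S \<Longrightarrow> f i \<notin> P"
  shows "prod f S \<notin> P"
proof -
  have "1 \<notin> P" using assms(1) ideal_eq_UNIV_iff by (auto simp: is_prime_ideal_def)
  with assms(2) show ?thesis
    by (induction S rule: infinite_finite_induct)
       (use assms(1) in \<open>auto simp: is_prime_ideal_def\<close>)
qed

lemma noetherian_ex_maximal:
  fixes \<C> :: "'a::comm_ring_1 set set"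
  assumes "noetherian_ring TYPE('a)" "I0 \<in> \<C>" "\<And>I. I \<in> \<C> \<Longrightarrow> is_ideal I"
  shows "\<exists>I\<in>\<C>. \<forall>J\<in>\<C>. I \<subseteq> J \<longrightarrow> J = I"
proof (rule ccontr)
  assume "\<not> ?thesis"
  then have "\<forall>I\<in>\<C>. \<exists>J\<in>\<C>. I \<subset> J" by blast
  then obtain f where f: "\<And>n. f n \<in> \<C>" "\<And>n. f n \<subset> f (Suc n)"
    using dependent_nat_choice[of "\<lambda>_ I. I \<in> \<C>" "\<lambda>_ I J. I \<subset> J"] assms(2) by metis
  then obtain N where "\<forall>n\<ge>N. f n = f N"
    using assms(1,3) unfolding noetherian_ring_def by (metis psubset_imp_subset)
  then have "f (Suc N) = f N" using le_SucI by blast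
  then show False using f(2)[of N] by simp
qed

text \<open>The quotient \<open>b / a\<close> is integral over the ring, because the finitely generated
  ideals spanned by the initial segments of the sequence stabilise.\<close>

lemma dvd_if_geometric_sequence:
  fixes p :: "nat \<Rightarrow> 'a::idom"
  assumes "noetherian_ring TYPE('a)" "integrally_closed TYPE('a)"
    and "p 0 \<noteq> 0" "a \<noteq> 0" and rec: "\<And>k. a * p (Suc k) = b * p k"
  shows "a dvd b"
proof -
  define I where "I n = {\<Sum>k\<le>n. d k * p k |d. True}" for n
  have II: "x \<in> I n" if "x = (\<Sum>k\<le>n. d k * p k)" for x n d
    unfolding I_def using that by (intro CollectI exI[of _ d]) simp
  have "is_ideal (I n)" for n
    unfolding is_ideal_def
  proof (intro conjI ballI allI)
    show "0 \<in> I n" by (rule II[of _ "\<lambda>_. 0"]) simp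
  next
    fix x y assume "x \<in> I n" "y \<in> I n"
    then obtain d e where "x = (\<Sum>k\<le>n. d k * p k)" "y = (\<Sum>k\<le>n. e k * p k)"
      unfolding I_def by blast
    then have "x + y = (\<Sum>k\<le>n. (d k + e k) * p k)" by (simp add: sum.distrib algebra_simps)
    then show "x + y \<in> I n" by (rule II)
  next
    fix r x assume "x \<in> I n"
    then obtain d where "x = (\<Sum>k\<le>n. d k * p k)" unfolding I_def by blast
    then have "r * x = (\<Sum>k\<le>n. (r * d k) * p k)" by (simp add: sum_distrib_left algebra_simps)
    then show "r * x \<in> I n" by (rule II)
  qed
  moreover have "I n \<subseteq> I (Suc n)" for n
  proof
    fix x assume "x \<in> I n"
    then obtain d where "x = (\<Sum>k\<le>n. d k * p k)" unfolding I_def by blast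
    then have "x = (\<Sum>k\<le>Suc n. (d(Suc n := 0)) k * p k)" by simp
    then show "x \<in> I (Suc n)" by (rule II)
  qed
  ultimately obtain N where N: "\<forall>n\<ge>N. I n = I N"
    using assms(1) unfolding noetherian_ring_def by metis
  have "p (Suc N) \<in> I (Suc N)"
    by (rule II[of _ "\<lambda>k. if k = Suc N then 1 else 0"]) simp
  then have "p (Suc N) \<in> I N" using N by (metis le_SucI order_refl)
  then obtain d where d: "p (Suc N) = (\<Sum>k\<le>N. d k * p k)" unfolding I_def by blast
  define y where "y = to_fract b / to_fract a"
  have a0: "to_fract a \<noteq> 0" using \<open>a \<noteq> 0\<close> by simp
  have pk: "to_fract (p k) = y ^ k * to_fract (p 0)" for k
  proof (induction k)
    case (Suc k)
    have "to_fract a * to_fract (p (Suc k)) = to_fract b * to_fract (p k)"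
      using rec[of k] by (metis to_fract_mult)
    then have "to_fract (p (Suc k)) = y * to_fract (p k)"
      unfolding y_def using a0 by (simp add: field_simps)
    with Suc show ?case by simp
  qed simp
  \<comment> \<open>Since \<open>p k\<close> is \<open>y ^ k * p 0\<close> in the fraction field,
    dividing the relation for \<open>p (Suc N)\<close> by \<open>p 0\<close> gives a monic equation
    for \<open>y\<close>.\<close>
  define q where "q = monom 1 (Suc N) - (\<Sum>k\<le>N. monom (d k) k)"
  have small: "degree (\<Sum>k\<le>N. monom (d k) k) < Suc N"
    by (intro le_imp_less_Suc degree_sum_le) (auto intro: order.trans[OF degree_monom_le])
  have "lead_coeff q = 1"
  proof -
    have "degree q = Suc N"
      unfolding q_def diff_conv_add_uminus using small
      by (subst degree_add_eq_left) (auto simp: degree_monom_eq)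
    then show ?thesis unfolding q_def using small by (simp add: coeff_eq_0)
  qed
  moreover have "poly (map_poly to_fract q) y = 0"
  proof -
    have sum: "map_poly to_fract (\<Sum>k\<in>K. monom (d k) k) = (\<Sum>k\<in>K. monom (to_fract (d k)) k)"
      for K :: "nat set"
      by (induction K rule: infinite_finite_induct) (auto simp: map_poly_monom)
    have "poly (map_poly to_fract q) y * to_fract (p 0)
        = (y ^ Suc N - (\<Sum>k\<le>N. to_fract (d k) * y ^ k)) * to_fract (p 0)"
      by (simp add: q_def sum map_poly_monom poly_monom poly_sum)
    also have "\<dots> = to_fract (p (Suc N)) - (\<Sum>k\<le>N. to_fract (d k) * to_fract (p k))"
      unfolding pk[of "Suc N"] by (subst pk) (simp add: algebra_simps sum_distrib_left)
    also have "\<dots> = to_fract (p (Suc N) - (\<Sum>k\<le>N. d k * p k))" by simp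
    also have "\<dots> = 0" using d by simp
    finally show ?thesis using \<open>p 0 \<noteq> 0\<close> by simp
  qed
  ultimately obtain z where "y = to_fract z"
    using assms(2) unfolding integrally_closed_def by blast
  then have "to_fract b = to_fract (a * z)" using a0 by (simp add: y_def field_simps)
  then show ?thesis by (metis dvd_triv_left to_fract_eq_iff)
qed

text \<open>Equivalently, \<open>t\<close> generates the maximal ideal of the localization at \<open>P\<close>.\<close>

definition uniformizer :: "'a::comm_ring_1 set \<Rightarrow> 'a \<Rightarrow> bool" where
  "uniformizer P t \<longleftrightarrow> t \<in> P \<and> (\<exists>s. s \<notin> P \<and> (\<forall>p\<in>P. t dvd s * p))"

text \<open>\<open>P\<close> is an associated prime of the ring modulo \<open>a\<close>. Among the
  \<open>b\<close> that \<open>a\<close> does not divide even after localizing at \<open>P\<close>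
  (\<open>good\<close>), take one with maximal \<open>C b\<close>. This ideal is prime, contains
  \<open>a\<close> and lies inside \<open>P\<close>; as nonzero primes are maximal, it is
  \<open>P\<close>.\<close>

lemma ex_colon_ideal_eq:
  fixes P :: "'a::idom set"
  assumes D: "dedekind_domain TYPE('a)" and P: "is_maximal_ideal P" and a: "a \<in> P" "a \<noteq> 0"
  shows "\<exists>b. \<not> a dvd b \<and> P = {x. a dvd x * b}"
proof -
  have Pp: "is_prime_ideal P" and Pi: "is_ideal P" and P1: "1 \<notin> P"
    using P maximal_ideal_imp_prime ideal_eq_UNIV_iff by (auto simp: is_maximal_ideal_def)
  have Pm: "x * y \<notin> P" if "x \<notin> P" "y \<notin> P" for x y
    using Pp that by (auto simp: is_prime_ideal_def)
  define C where "C b = {x. a dvd x * b}" for b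
  define good where "good b \<longleftrightarrow> (\<forall>s. s \<notin> P \<longrightarrow> \<not> a dvd s * b)" for b
  have ideal: "is_ideal (C b)" for b
    unfolding is_ideal_def C_def by (auto simp: algebra_simps)
  have "good 1"
    using ideal_mult_right[OF Pi a(1)] unfolding good_def dvd_def by fastforce
  then have "\<exists>I\<in>C ` Collect good. \<forall>J\<in>C ` Collect good. I \<subseteq> J \<longrightarrow> J = I"
    using D ideal by (intro noetherian_ex_maximal[of "C 1"]) (auto simp: dedekind_domain_def)
  then obtain b where b: "good b" and max: "\<And>b'. good b' \<Longrightarrow> C b \<subseteq> C b' \<Longrightarrow> C b' = C b"
    by auto
  have sub: "C b \<subseteq> P" using b unfolding C_def good_def by blast
  have "is_prime_ideal (C b)"
    unfolding is_prime_ideal_def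
  proof (intro conjI allI impI ideal)
    show "C b \<noteq> UNIV" using sub P1 by blast
    fix x y assume xy: "x * y \<in> C b"
    show "x \<in> C b \<or> y \<in> C b"
    proof (cases "good (y * b)")
      case True
      have "C b \<subseteq> C (y * b)" by (auto simp: C_def mult.left_commute[of _ y])
      with max[OF True] have "C (y * b) = C b" .
      with xy show ?thesis by (auto simp: C_def mult.assoc)
    next
      case False
      \<comment> \<open>\<open>y\<close> lies in \<open>C (s * b)\<close>, which maximality
        identifies with \<open>C b\<close>.\<close>
      then obtain s where s: "s \<notin> P" "a dvd s * (y * b)" unfolding good_def by blast
      have "good (s * b)"
        using b Pm[OF _ s(1)] unfolding good_def by (metis mult.assoc)
      moreover have "C b \<subseteq> C (s * b)" by (auto simp: C_def mult.left_commute[of _ s])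
      ultimately have "C (s * b) = C b" by (rule max)
      moreover have "y \<in> C (s * b)" using s(2) by (simp add: C_def mult.left_commute[of y])
      ultimately show ?thesis by blast
    qed
  qed
  moreover have "a \<in> C b" by (simp add: C_def)
  then have "C b \<noteq> {0}" using a(2) by blast
  ultimately have "is_maximal_ideal (C b)" using D by (auto simp: dedekind_domain_def)
  then have "P = C b" using sub P by (auto simp: is_maximal_ideal_def)
  moreover have "\<not> a dvd b" using b P1 unfolding good_def by (metis mult_1)
  ultimately show ?thesis unfolding C_def by blast
qed

text \<open>Multiplication by \<open>b / a\<close> maps \<open>P\<close> into the ring; call it
  \<open>\<phi>\<close>. If it preserved \<open>P\<close>, its iterates at \<open>a\<close> would be
  geometric with ratio \<open>b / a\<close>, forcing \<open>a dvd b\<close>. So some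
  \<open>\<phi> t\<close> is outside \<open>P\<close>, and
  \<open>\<phi> t * p = t * \<phi> p\<close> makes it the multiplier in the definition.\<close>

lemma ex_uniformizer:
  fixes P :: "'a::idom set"
  assumes D: "dedekind_domain TYPE('a)" and P: "is_maximal_ideal P" and "P \<noteq> {0}"
  shows "\<exists>t. uniformizer P t"
proof -
  have Pi: "is_ideal P" using P by (simp add: is_maximal_ideal_def)
  then obtain a where a: "a \<in> P" "a \<noteq> 0" using \<open>P \<noteq> {0}\<close> ideal_zero by blast
  obtain b where b: "\<not> a dvd b" "P = {x. a dvd x * b}"
    using ex_colon_ideal_eq[OF D P a] by blast
  then have "\<forall>p\<in>P. \<exists>q. b * p = a * q" by (auto simp: dvd_def mult.commute)
  then obtain \<phi> where \<phi>: "\<And>p. p \<in> P \<Longrightarrow> b * p = a * \<phi> p" by metis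
  have "\<exists>t\<in>P. \<phi> t \<notin> P"
  proof (rule ccontr)
    assume "\<not> ?thesis"
    then have "(\<phi> ^^ k) a \<in> P" for k using a(1) by (induction k) auto
    then have "a * (\<phi> ^^ Suc k) a = b * (\<phi> ^^ k) a" for k using \<phi> by simp
    then have "a dvd b"
      using dvd_if_geometric_sequence[of "\<lambda>k. (\<phi> ^^ k) a" a b] D a(2)
      by (simp add: dedekind_domain_def)
    with b(1) show False by simp
  qed
  then obtain t where t: "t \<in> P" "\<phi> t \<notin> P" by blast
  have "\<phi> t * p = t * \<phi> p" if "p \<in> P" for p
  proof -
    have "a * (\<phi> t * p) = a * (t * \<phi> p)"
      using \<phi>[OF t(1)] \<phi>[OF that] by (metis mult.assoc mult.left_commute)
    then show ?thesis using a(2) by simp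
  qed
  then have "uniformizer P t" using t unfolding uniformizer_def by (metis dvd_triv_left)
  then show ?thesis ..
qed

lemma uniformizer_nonzero:
  fixes P :: "'a::idom set"
  assumes "is_ideal P" "P \<noteq> {0}" "uniformizer P t"
  shows "t \<noteq> 0"
proof
  assume "t = 0"
  with assms(3) obtain s where "s \<notin> P" "\<forall>p\<in>P. s * p = 0" unfolding uniformizer_def by auto
  with assms(1,2) ideal_zero show False by fastforce
qed

text \<open>With \<open>s * z = x * m z\<close> for \<open>z \<in> P\<close>, multiplying \<open>w * x + y * z\<close> by \<open>s\<^sup>2\<close> makes it
  \<open>x\<close> times an element outside \<open>P\<close>.\<close>

lemma uniformizer_perturb:
  assumes P: "is_prime_ideal P" and x: "uniformizer P x" and w: "w \<notin> P"
    and r: "r = (\<Sum>i\<in>I. y i * z i)" "\<And>i. i \<in> I \<Longrightarrow> y i \<in> P" "\<And>i. i \<in> I \<Longrightarrow> z i \<in> P"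
  shows "uniformizer P (w * x + r)"
proof -
  have Pi: "is_ideal P" and Pm: "\<And>u v. u \<notin> P \<Longrightarrow> v \<notin> P \<Longrightarrow> u * v \<notin> P"
    using P by (auto simp: is_prime_ideal_def)
  obtain s where xP: "x \<in> P" and s: "s \<notin> P" "\<forall>p\<in>P. x dvd s * p"
    using x unfolding uniformizer_def by blast
  have "x * x dvd s * s * r"
    unfolding r(1) sum_distrib_left
  proof (rule dvd_sum)
    fix i assume "i \<in> I"
    then have "x * x dvd (s * y i) * (s * z i)" using s(2) r(2,3) by (intro mult_dvd_mono) auto
    then show "x * x dvd s * s * (y i * z i)" by (simp add: mult_ac)
  qed
  then obtain m where m: "s * s * r = x * (x * m)" by (auto simp: dvd_def mult.assoc)
  define v where "v = w * s * s + x * m"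
  have v: "s * s * (w * x + r) = v * x" using m by (simp add: v_def algebra_simps)
  have "v \<notin> P"
  proof
    assume "v \<in> P"
    then have "v - x * m \<in> P" using ideal_diff[OF Pi] ideal_mult_right[OF Pi xP] by blast
    then show False using Pm[OF Pm[OF w s(1)] s(1)] by (simp add: v_def)
  qed
  have "w * x + r dvd (v * s) * p" if p: "p \<in> P" for p
  proof -
    obtain q where "s * p = x * q" using s(2) p by (meson dvdE)
    then have "(v * s) * p = (v * x) * q" by (simp add: mult.assoc)
    also have "\<dots> = (w * x + r) * (s * s * q)" unfolding v[symmetric] by (simp add: mult_ac)
    finally show ?thesis by simp
  qed
  moreover have "w * x + r \<in> P"
    unfolding r(1) using r(2,3) xP
    by (intro ideal_add[OF Pi] ideal_sum[OF Pi] ideal_mult_left[OF Pi]) auto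
  moreover have "v * s \<notin> P" using Pm \<open>v \<notin> P\<close> s(1) by blast
  ultimately show ?thesis unfolding uniformizer_def by blast
qed

text \<open>A Chinese remainder argument: \<open>z i\<close> avoids \<open>P i\<close> but lies in
  every other \<open>P j\<close>. The result is a combination of the \<open>x i\<close>, which keeps
  it inside \<open>J\<close>.\<close>

lemma ex_simultaneous_approximation:
  fixes P :: "'i \<Rightarrow> 'a::comm_ring_1 set" and x :: "'i \<Rightarrow> 'a"
  assumes I: "finite I" "inj_on P I" "\<And>i. i \<in> I \<Longrightarrow> is_maximal_ideal (P i)"
    and J: "is_ideal J" "\<And>i. i \<in> I \<Longrightarrow> x i \<in> J"
  shows "\<exists>b\<in>J. \<forall>i\<in>I. (b \<in> P i \<longleftrightarrow> x i \<in> P i) \<and> (uniformizer (P i) (x i) \<longrightarrow> uniformizer (P i) b)"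
proof -
  have prime: "is_prime_ideal (P i)" and ideal: "is_ideal (P i)" if "i \<in> I" for i
    using I(3)[OF that] maximal_ideal_imp_prime by (auto simp: is_maximal_ideal_def)
  have "\<exists>z. z \<notin> P i \<and> (\<forall>j\<in>I - {i}. z \<in> P j)" if i: "i \<in> I" for i
  proof -
    have "\<exists>q. q \<in> P j \<and> q \<notin> P i" if j: "j \<in> I - {i}" for j
    proof -
      have "P i \<noteq> P j" using I(2) i j by (auto dest: inj_onD)
      then show ?thesis using I(3)[OF i] I(3)[of j] j unfolding is_maximal_ideal_def by blast
    qed
    then obtain q where q: "\<And>j. j \<in> I - {i} \<Longrightarrow> q j \<in> P j \<and> q j \<notin> P i" by metis
    have "(\<Prod>j\<in>I - {i}. q j) \<notin> P i" using q by (intro prime_ideal_prod_notin prime i) auto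
    moreover have "(\<Prod>j\<in>I - {i}. q j) \<in> P k" if k: "k \<in> I - {i}" for k
    proof -
      have "(\<Prod>j\<in>I - {i}. q j) = q k * (\<Prod>j\<in>I - {i} - {k}. q j)"
        using k I(1) by (intro prod.remove) auto
      then show ?thesis using ideal_mult_right[OF ideal] q k by auto
    qed
    ultimately show ?thesis by blast
  qed
  then obtain z where z: "\<And>i. i \<in> I \<Longrightarrow> z i \<notin> P i" "\<And>i j. i \<in> I \<Longrightarrow> j \<in> I - {i} \<Longrightarrow> z i \<in> P j"
    by metis
  \<comment> \<open>Squaring \<open>z i\<close> puts the summands of the other indices into the
    square of each ideal, as \<open>uniformizer_perturb\<close> requires.\<close>
  define b where "b = (\<Sum>i\<in>I. z i * z i * x i)"
  have "b \<in> J" unfolding b_def using J by (intro ideal_sum ideal_mult_left) auto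
  moreover have "(b \<in> P i \<longleftrightarrow> x i \<in> P i) \<and> (uniformizer (P i) (x i) \<longrightarrow> uniformizer (P i) b)"
    if i: "i \<in> I" for i
  proof -
    define r where "r = (\<Sum>j\<in>I - {i}. z j * (z j * x j))"
    have b: "b = z i * z i * x i + r"
      unfolding b_def r_def using I(1) i by (subst sum.remove) (auto simp: mult.assoc)
    have zi: "z j \<in> P i" "z j * x j \<in> P i" if "j \<in> I - {i}" for j
      using z(2)[of j i] that i ideal_mult_right[OF ideal] by auto
    have zz: "z i * z i \<notin> P i" using z(1)[OF i] prime[OF i] by (auto simp: is_prime_ideal_def)
    have ri: "r \<in> P i" unfolding r_def by (intro ideal_sum ideal_mult_left ideal i zi)
    have "b \<in> P i \<longleftrightarrow> z i * z i * x i \<in> P i"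
      unfolding b using ri ideal_add[OF ideal[OF i]] ideal_diff[OF ideal[OF i]]
      by (metis add_diff_cancel_right')
    also have "\<dots> \<longleftrightarrow> x i \<in> P i"
      using zz prime[OF i] ideal_mult_left[OF ideal[OF i]] unfolding is_prime_ideal_def by blast
    finally show ?thesis
      using uniformizer_perturb[OF prime[OF i] _ zz r_def zi] unfolding b by blast
  qed
  ultimately show ?thesis by blast
qed

section \<open>Exponents of the residue fields\<close>

lemma one_minus_power_in_ideal:
  assumes "is_ideal P" "1 - a ^ d \<in> P" "d dvd m"
  shows "1 - a ^ m \<in> P"
proof -
  from assms(3) obtain k where "m = d * k" by blast
  then show ?thesis
    using ideal_mult_right[OF assms(1,2)] one_diff_power_eq[of "a ^ d" k] by (simp add: power_mult)
qed

text \<open>Among the powers of \<open>a\<close> up to \<open>a ^ N\<close> two share a coset.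
  Cancelling the lower one leaves an exponent at most \<open>N\<close>, and all such exponents
  divide \<open>fact N\<close>, which does not depend on \<open>a\<close>.\<close>

lemma finite_index_ex_exponent:
  assumes P: "is_prime_ideal P" and "finite_index P"
  shows "\<exists>m>0. \<forall>a. a \<notin> P \<longrightarrow> 1 - a ^ m \<in> P"
proof -
  have Pi: "is_ideal P" using P by (simp add: is_prime_ideal_def)
  define N where "N = card (range (\<lambda>a. (+) a ` P))"
  have fin: "finite (range (\<lambda>a. (+) a ` P))" using assms(2) by (simp add: finite_index_def)
  have "1 - a ^ fact N \<in> P" if a: "a \<notin> P" for a
  proof -
    have "\<not> inj_on (\<lambda>i. (+) (a ^ i) ` P) {..N}"
    proof
      assume "inj_on (\<lambda>i. (+) (a ^ i) ` P) {..N}"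
      then have "card {..N} \<le> N" unfolding N_def by (rule card_inj_on_le) (use fin in auto)
      then show False by simp
    qed
    then obtain i j where ij: "i < j" "j \<le> N" "(+) (a ^ i) ` P = (+) (a ^ j) ` P"
      unfolding inj_on_def by (metis atMost_iff linorder_neqE_nat)
    have "a ^ i + 0 \<in> (+) (a ^ i) ` P" using ideal_zero[OF Pi] by blast
    then obtain p where p: "a ^ i = a ^ j + p" "p \<in> P" using ij(3) by auto
    have "a ^ i * (1 - a ^ (j - i)) = a ^ i - a ^ j"
      using ij(1) by (simp add: right_diff_distrib flip: power_add)
    with p have "a ^ i * (1 - a ^ (j - i)) \<in> P" by simp
    moreover have "a ^ i \<notin> P"
      using prime_ideal_prod_notin[OF P, of "{..<i}" "\<lambda>_. a"] a by simp
    ultimately have "1 - a ^ (j - i) \<in> P" using P by (auto simp: is_prime_ideal_def)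
    moreover have "j - i dvd fact N" using ij by (intro dvd_fact) auto
    ultimately show ?thesis by (rule one_minus_power_in_ideal[OF Pi])
  qed
  then show ?thesis by (metis fact_gt_zero)
qed

lemma finite_index_ex_common_exponent:
  assumes "finite S" "\<And>P. P \<in> S \<Longrightarrow> is_prime_ideal P" "\<And>P. P \<in> S \<Longrightarrow> finite_index P"
  shows "\<exists>m>0. \<forall>P\<in>S. \<forall>a. a \<notin> P \<longrightarrow> 1 - a ^ m \<in> P"
proof -
  have "\<forall>P\<in>S. \<exists>m>0. \<forall>a. a \<notin> P \<longrightarrow> 1 - a ^ m \<in> P"
    using finite_index_ex_exponent assms(2,3) by blast
  then obtain m where m: "\<And>P. P \<in> S \<Longrightarrow> m P > 0"
      "\<And>P a. P \<in> S \<Longrightarrow> a \<notin> P \<Longrightarrow> 1 - a ^ m P \<in> P"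
    by metis
  have "1 - a ^ (\<Prod>P\<in>S. m P) \<in> P" if "P \<in> S" "a \<notin> P" for P a
    using m(2)[OF that] that assms(1,2) unfolding is_prime_ideal_def
    by (blast intro: one_minus_power_in_ideal dvd_prodI)
  moreover have "(\<Prod>P\<in>S. m P) > 0" using m(1) by (simp add: prod_pos)
  ultimately show ?thesis by blast
qed

section \<open>Localization at a maximal ideal\<close>

definition localization :: "'a::idom set \<Rightarrow> 'a fract set" where
  "localization P = {x. \<exists>d s. s \<notin> P \<and> x * to_fract s = to_fract d}"

definition localization_ideal :: "'a::idom set \<Rightarrow> 'a fract set" where
  "localization_ideal P = {x. \<exists>d s. d \<in> P \<and> s \<notin> P \<and> x * to_fract s = to_fract d}"

text \<open>Numerator and denominator are divided by a uniformizer as long as both lie in \<open>P\<close>.\<close>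

lemma ex_reduced_fraction:
  fixes P :: "'a::idom set"
  assumes D: "dedekind_domain TYPE('a)" and P: "is_maximal_ideal P" "P \<noteq> {0}" and a: "a \<noteq> 0"
  shows "\<exists>a' b'. a * b' = a' * b \<and> (a' \<notin> P \<or> b' \<notin> P)"
proof (rule ccontr)
  assume "\<not> ?thesis"
  then have inP: "a' \<in> P" "b' \<in> P" if "a * b' = a' * b" for a' b' using that by blast+
  have Pi: "is_ideal P" using P(1) by (simp add: is_maximal_ideal_def)
  obtain t where t: "uniformizer P t" using ex_uniformizer[OF D P] ..
  then have t0: "t \<noteq> 0" using uniformizer_nonzero[OF Pi P(2)] by blast
  from t obtain s where tP: "t \<in> P" and s: "s \<notin> P" "\<forall>p\<in>P. t dvd s * p"
    unfolding uniformizer_def by blast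
  then have "\<forall>p\<in>P. \<exists>q. t * q = s * p" by (metis dvdE)
  then obtain \<phi> where \<phi>: "\<And>p. p \<in> P \<Longrightarrow> t * \<phi> p = s * p" by metis
  have eq: "a * (\<phi> ^^ k) b = (\<phi> ^^ k) a * b" for k
  proof (induction k)
    case (Suc k)
    have "t * (a * \<phi> ((\<phi> ^^ k) b)) = a * (s * (\<phi> ^^ k) b)"
      using \<phi>[OF inP(2)[OF Suc]] by (simp add: mult.left_commute)
    also have "\<dots> = s * ((\<phi> ^^ k) a * b)" using Suc by (simp add: mult.left_commute)
    also have "\<dots> = t * (\<phi> ((\<phi> ^^ k) a) * b)"
      using \<phi>[OF inP(1)[OF Suc]] by (simp add: mult.assoc[symmetric])
    finally show ?case using t0 by simp
  qed simp
  \<comment> \<open>In the fraction field the iterates of \<open>a\<close> have ratio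
    \<open>s / t\<close>, so \<open>t\<close> would divide \<open>s\<close> and put it into
    \<open>P\<close>.\<close>
  have "t * (\<phi> ^^ Suc k) a = s * (\<phi> ^^ k) a" for k using \<phi>[OF inP(1)[OF eq[of k]]] by simp
  then have "t dvd s"
    using dvd_if_geometric_sequence[of "\<lambda>k. (\<phi> ^^ k) a" t s] D a t0
    by (simp add: dedekind_domain_def)
  with tP s(1) ideal_mult_right[OF Pi] show False by auto
qed

lemma valuation_subring_localization:
  fixes P :: "'a::idom set"
  assumes D: "dedekind_domain TYPE('a)" and P: "is_maximal_ideal P" "P \<noteq> {0}"
  shows "valuation_subring (localization P) (localization_ideal P)"
proof
  have Pp: "is_prime_ideal P" and Pi: "is_ideal P"
    using P(1) maximal_ideal_imp_prime by (auto simp: is_maximal_ideal_def)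
  then have P1: "1 \<notin> P" using ideal_eq_UNIV_iff by (auto simp: is_prime_ideal_def)
  have Pm: "u * v \<notin> P" if "u \<notin> P" "v \<notin> P" for u v using Pp that by (auto simp: is_prime_ideal_def)
  show "localization_ideal P \<subseteq> localization P"
    unfolding localization_def localization_ideal_def by blast
  show "0 \<in> localization_ideal P"
    unfolding localization_ideal_def using P1 ideal_zero[OF Pi]
    by (intro CollectI exI[of _ 0] exI[of _ 1]) simp
  show "1 \<in> localization P"
    unfolding localization_def using P1 by (auto intro!: exI[of _ 1])
  show "1 \<notin> localization_ideal P"
    unfolding localization_ideal_def by auto
  show "x + y \<in> localization_ideal P" if xy: "x \<in> localization_ideal P" "y \<in> localization_ideal P" for x y
  proof -
    obtain d s d' s' where *: "d \<in> P" "s \<notin> P" "x * to_fract s = to_fract d"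
        "d' \<in> P" "s' \<notin> P" "y * to_fract s' = to_fract d'"
      using xy unfolding localization_ideal_def by blast
    have "(x + y) * to_fract (s * s') = to_fract (d * s' + d' * s)"
      by (simp add: *(3,6)[symmetric] algebra_simps)
    moreover have "d * s' + d' * s \<in> P" using * ideal_add[OF Pi] ideal_mult_right[OF Pi] by blast
    ultimately show ?thesis unfolding localization_ideal_def using Pm[OF *(2,5)] by blast
  qed
  show "x * y \<in> localization P" if xy: "x \<in> localization P" "y \<in> localization P" for x y
  proof -
    obtain d s d' s' where *: "s \<notin> P" "x * to_fract s = to_fract d"
        "s' \<notin> P" "y * to_fract s' = to_fract d'"
      using xy unfolding localization_def by blast
    have "(x * y) * to_fract (s * s') = to_fract (d * d')"
      by (simp add: *(2,4)[symmetric] algebra_simps)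
    then show ?thesis unfolding localization_def using Pm[OF *(1,3)] by blast
  qed
  show "x * y \<in> localization_ideal P" if xy: "x \<in> localization P" "y \<in> localization_ideal P" for x y
  proof -
    obtain d s d' s' where *: "s \<notin> P" "x * to_fract s = to_fract d"
        "s' \<notin> P" "y * to_fract s' = to_fract d'" "d' \<in> P"
      using xy unfolding localization_def localization_ideal_def by blast
    have "(x * y) * to_fract (s * s') = to_fract (d * d')"
      by (simp add: *(2,4)[symmetric] algebra_simps)
    then show ?thesis unfolding localization_ideal_def
      using Pm[OF *(1,3)] ideal_mult_left[OF Pi *(5)] by blast
  qed
  show "inverse x \<in> localization_ideal P" if x: "x \<notin> localization P" for x
  proof (cases x)
    case (Fract a b)
    then have xab: "x = to_fract a / to_fract b" and b: "b \<noteq> 0" by (auto simp: Fract_conv_to_fract)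
    have "0 \<in> localization P"
      unfolding localization_def using P1 by (intro CollectI exI[of _ 0] exI[of _ 1]) simp
    then have "x \<noteq> 0" using x by blast
    with xab have a: "a \<noteq> 0" by auto
    obtain a' b' where ab: "a * b' = a' * b" "a' \<notin> P \<or> b' \<notin> P"
      using ex_reduced_fraction[OF D P a] by blast
    have "to_fract a * to_fract b' = to_fract a' * to_fract b"
      using ab(1) by (metis to_fract_mult)
    then have *: "x * to_fract b' = to_fract a'" "inverse x * to_fract a' = to_fract b'"
      unfolding xab using a b by (auto simp: field_simps)
    \<comment> \<open>Otherwise \<open>x\<close> would be a fraction with denominator
      \<open>b'\<close> outside \<open>P\<close>. So \<open>a'\<close> is outside \<open>P\<close>
      and serves as denominator of the inverse.\<close>
    with x have "b' \<in> P" unfolding localization_def by blast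
    with ab(2) * show ?thesis unfolding localization_ideal_def by blast
  qed
qed

lemma to_fract_in_localization:
  assumes "is_prime_ideal P"
  shows "to_fract a \<in> localization P" "to_fract a \<in> localization_ideal P \<longleftrightarrow> a \<in> P"
proof -
  have P1: "1 \<notin> P" using assms ideal_eq_UNIV_iff by (auto simp: is_prime_ideal_def)
  then show "to_fract a \<in> localization P" unfolding localization_def by force
  show "to_fract a \<in> localization_ideal P \<longleftrightarrow> a \<in> P"
  proof
    assume "to_fract a \<in> localization_ideal P"
    then obtain d s where "d \<in> P" "s \<notin> P" "to_fract (a * s) = to_fract d"
      unfolding localization_ideal_def by auto
    then have "a * s \<in> P" "s \<notin> P" by (auto simp del: to_fract_mult)
    then show "a \<in> P" using assms by (auto simp: is_prime_ideal_def)
  next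
    assume "a \<in> P"
    then show "to_fract a \<in> localization_ideal P"
      unfolding localization_ideal_def using P1 by force
  qed
qed

text \<open>A uniformizer has valuation one, a product of two elements of the maximal ideal at least
  two. In the ring: clear denominators, multiply by \<open>r\<close> and cancel \<open>t\<close>; an
  element outside \<open>P\<close> becomes a multiple of \<open>d'\<close>.\<close>

lemma uniformizer_not_product:
  fixes P :: "'a::idom set"
  assumes P: "is_prime_ideal P" "P \<noteq> {0}" and t: "uniformizer P t"
    and "x \<in> localization_ideal P" "y \<in> localization_ideal P"
  shows "to_fract t \<noteq> x * y"
proof
  assume txy: "to_fract t = x * y"
  have Pi: "is_ideal P" and Pm: "\<And>u v. u \<notin> P \<Longrightarrow> v \<notin> P \<Longrightarrow> u * v \<notin> P"
    using P(1) by (auto simp: is_prime_ideal_def)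
  obtain d s d' s' where *: "d \<in> P" "s \<notin> P" "x * to_fract s = to_fract d"
      "d' \<in> P" "s' \<notin> P" "y * to_fract s' = to_fract d'"
    using assms(4,5) unfolding localization_ideal_def by blast
  have "to_fract (t * (s * s')) = to_fract (d * d')"
    by (simp add: txy *(3,6)[symmetric] algebra_simps)
  then have ts: "t * (s * s') = d * d'" by (simp only: to_fract_eq_iff)
  obtain r where r: "r \<notin> P" "\<forall>p\<in>P. t dvd r * p" using t unfolding uniformizer_def by blast
  then obtain q where "r * d = t * q" using *(1) by (meson dvdE)
  then have "t * (r * (s * s')) = t * (q * d')" using ts by (metis mult.assoc mult.left_commute)
  then have "r * (s * s') = q * d'" using uniformizer_nonzero[OF Pi P(2) t] by simp
  then have "r * (s * s') \<in> P" using ideal_mult_left[OF Pi *(4)] by simp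
  with Pm[OF r(1) Pm[OF *(2,5)]] show False by blast
qed

section \<open>Irreducible integer-valued polynomials\<close>

lemma to_fract_prod: "to_fract (prod f A) = (\<Prod>i\<in>A. to_fract (f i))"
  by (induction A rule: infinite_finite_induct) auto

lemma to_fract_power: "to_fract (a ^ n) = to_fract a ^ n"
  by (induction n) auto

text \<open>Interpolates between \<open>e\<close> at 0 (for positive \<open>m\<close>) and
  \<open>c\<close> at 1; modulo an ideal containing \<open>1 - a ^ m\<close>, the value at
  \<open>a\<close> is \<open>c\<close>. The case \<open>m = 1\<close> gives the linear
  factors.\<close>

definition interp_poly :: "nat \<Rightarrow> 'a::idom \<Rightarrow> 'a \<Rightarrow> 'a fract poly" where
  "interp_poly m e c = [:to_fract e:] + monom (to_fract (c - e)) m"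

lemma poly_interp_poly: "poly (interp_poly m e c) (to_fract a) = to_fract (e * (1 - a ^ m) + c * a ^ m)"
  by (simp add: interp_poly_def poly_monom to_fract_power algebra_simps)

lemma poly_interp_poly_0: "m > 0 \<Longrightarrow> poly (interp_poly m e c) 0 = to_fract e"
  using poly_interp_poly[of m e c 0] by (simp add: zero_power)

lemma poly_interp_poly_1: "poly (interp_poly m e c) 1 = to_fract c"
  using poly_interp_poly[of m e c 1] by simp

lemma degree_interp_poly: "e \<noteq> c \<Longrightarrow> degree (interp_poly m e c) = m"
  by (cases "m = 0")
     (auto simp: interp_poly_def degree_monom_eq degree_add_eq_right monom_0 simp flip: to_fract_diff)

lemma irreducible_linear_interp_poly: "e \<noteq> c \<Longrightarrow> irreducible (interp_poly 1 e c)"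
  using degree_1_irreducible degree_interp_poly by metis

text \<open>Eisenstein at \<open>R\<close>: \<open>c - e\<close> is outside \<open>R\<close>, the
  inner coefficients vanish and the constant term is a uniformizer.\<close>

lemma irreducible_interp_poly:
  fixes R :: "'a::idom set"
  assumes D: "dedekind_domain TYPE('a)" and R: "is_maximal_ideal R" "R \<noteq> {0}"
    and e: "uniformizer R e" and c: "c \<notin> R" and m: "m > 0"
  shows "irreducible (interp_poly m e c)"
proof -
  interpret valuation_subring "localization R" "localization_ideal R"
    by (rule valuation_subring_localization[OF D R])
  have Rp: "is_prime_ideal R" and Ri: "is_ideal R"
    using R(1) maximal_ideal_imp_prime by (auto simp: is_maximal_ideal_def)
  have eR: "e \<in> R" using e by (simp add: uniformizer_def)
  then have ce: "c - e \<notin> R" using c ideal_add[OF Ri, of "c - e" e] by auto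
  have "e \<noteq> c" using eR c by blast
  then have deg: "degree (interp_poly m e c) = m" by (rule degree_interp_poly)
  have coeff_m: "coeff (interp_poly m e c) m = to_fract (c - e)"
    using m by (cases m) (simp_all add: interp_poly_def)
  have coeff_0: "coeff (interp_poly m e c) 0 = to_fract e"
    using m by (simp add: interp_poly_def)
  have coeff_i: "coeff (interp_poly m e c) i = 0" if "0 < i" "i < m" for i
    using that by (cases i) (simp_all add: interp_poly_def)
  show ?thesis
  proof (rule Eisenstein)
    show "degree (interp_poly m e c) > 0" using deg m by simp
    show "lead_coeff (interp_poly m e c) \<in> localization R"
      "lead_coeff (interp_poly m e c) \<notin> localization_ideal R"
      unfolding deg coeff_m using to_fract_in_localization[OF Rp] ce by blast+
    show "coeff (interp_poly m e c) i \<in> localization_ideal R" if "i < degree (interp_poly m e c)" for i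
    proof (cases "i = 0")
      case True
      then show ?thesis using coeff_0 to_fract_in_localization(2)[OF Rp] eR by simp
    next
      case False
      then show ?thesis using coeff_i that deg zero_M by simp
    qed
    show "coeff (interp_poly m e c) 0 \<noteq> x * y"
      if "x \<in> localization_ideal R" "y \<in> localization_ideal R" for x y
      unfolding coeff_0 using uniformizer_not_product[OF Rp R(2) e that] .
  qed
qed

lemma IntD_D: "f \<in> IntD \<Longrightarrow> \<exists>d. poly f (to_fract a) = to_fract d"
  by (auto simp: IntD_def image_iff)

text \<open>One criterion for \<open>H\<close>, \<open>G1\<close> and the \<open>L i\<close>. The
  prime \<open>f\<close> divides one factor \<open>g\<close>, so the cofactor \<open>h\<close> is a
  constant times some of the \<open>L i\<close>. Values at 1 control the constant, values at 0
  forbid splitting an \<open>L i\<close> off from \<open>f\<close>.\<close>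

lemma IntD_irreducible_quotient:
  fixes L :: "'i \<Rightarrow> 'a::idom fract poly" and c e :: 'a and b :: "'i \<Rightarrow> 'a" and P :: "'i \<Rightarrow> 'a set"
  assumes I: "finite I" and c: "c \<noteq> 0"
    and f: "irreducible f" "poly f 0 = to_fract e" "poly f 1 = to_fract c"
    and L: "\<And>i. i \<in> I \<Longrightarrow> irreducible (L i)" "\<And>i. i \<in> I \<Longrightarrow> poly (L i) 0 = to_fract (b i)"
      "\<And>i. i \<in> I \<Longrightarrow> poly (L i) 1 = 1"
    and P: "\<And>j. j \<in> I \<Longrightarrow> is_prime_ideal (P j)" "\<And>j. j \<in> I \<Longrightarrow> c \<in> P j" "\<And>j. j \<in> I \<Longrightarrow> e \<notin> P j"
      "\<And>i j. i \<in> I \<Longrightarrow> j \<in> I \<Longrightarrow> i \<noteq> j \<Longrightarrow> b i \<notin> P j"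
    and H: "H = smult (1 / to_fract c) (f * (\<Prod>i\<in>I. L i))" "H \<in> IntD"
  shows "IntD_irreducible H"
proof -
  have c0: "to_fract c \<noteq> 0" using c by simp
  have key: "IntD_unit h" if gh: "g \<in> IntD" "h \<in> IntD" "H = g * h" and "f dvd g" for g h
  proof -
    obtain g' where g': "g = f * g'" using \<open>f dvd g\<close> by blast
    have "f \<noteq> 0" using f(1) by auto
    with gh(3) g' H(1) have "g' * h = smult (1 / to_fract c) (\<Prod>i\<in>I. L i)"
      by (metis mult.assoc mult_left_cancel mult_smult_right)
    then obtain T k1 k2 where T: "T \<subseteq> I" and k: "k1 * k2 = 1 / to_fract c"
      and g'T: "g' = smult k1 (\<Prod>i\<in>T. L i)" and hT: "h = smult k2 (\<Prod>i\<in>I - T. L i)"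
      using prod_irreducible_factors[OF I, of L g' h "1 / to_fract c"] L(1) c by auto
    have "poly h (to_fract 1) = k2" using hT L(3) by (simp add: poly_prod)
    then obtain d where d: "k2 = to_fract d" using IntD_D[OF gh(2), of 1] by auto
    show ?thesis
    proof (cases "T = I")
      case True
      \<comment> \<open>This value lies in the ring and is inverse to the constant
        \<open>k2\<close>, so \<open>h\<close> is a unit.\<close>
      have "poly g (to_fract 1) = to_fract c * k1"
        using g' g'T T L(3) f(3) by (simp add: poly_prod subset_iff)
      then obtain d' where d': "to_fract c * k1 = to_fract d'" using IntD_D[OF gh(1), of 1] by auto
      have "to_fract d * to_fract d' = 1" using k c0 by (simp add: d[symmetric] d'[symmetric] field_simps)
      then have "h * [:to_fract d':] = 1" using hT True d by (simp add: mult.commute one_pCons)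
      moreover have "[:to_fract d':] \<in> IntD" by (auto simp: IntD_def)
      ultimately show ?thesis using gh(2) unfolding IntD_unit_def by blast
    next
      case False
      \<comment> \<open>With \<open>L j\<close> missing from \<open>g\<close>, the value of
        \<open>g\<close> at 0 makes \<open>c\<close> divide \<open>e\<close> times the product of
        the \<open>b i\<close> over \<open>T\<close>. That product would lie in \<open>P j\<close>,
        but none of its factors does.\<close>
      then obtain j where j: "j \<in> I" "j \<notin> T" using T by blast
      have "poly g (to_fract 0) = to_fract e * (k1 * (\<Prod>i\<in>T. to_fract (b i)))"
        using g' g'T T L(2) f(2) by (simp add: poly_prod subset_iff)
      then obtain d' where d': "to_fract e * (k1 * (\<Prod>i\<in>T. to_fract (b i))) = to_fract d'"
        using IntD_D[OF gh(1), of 0] by auto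
      have "to_fract (c * (d * d')) = to_fract c * (k1 * k2) * (to_fract e * (\<Prod>i\<in>T. to_fract (b i)))"
        by (simp add: d[symmetric] d'[symmetric])
      also have "\<dots> = to_fract (e * (\<Prod>i\<in>T. b i))" using k c0 by (simp add: to_fract_prod)
      finally have "c * (d * d') = e * (\<Prod>i\<in>T. b i)" by (simp only: to_fract_eq_iff)
      moreover have "c * (d * d') \<in> P j"
        using P(1,2)[OF j(1)] ideal_mult_right by (auto simp: is_prime_ideal_def)
      ultimately have "(\<Prod>i\<in>T. b i) \<in> P j"
        using P(1,3)[OF j(1)] by (auto simp: is_prime_ideal_def)
      moreover have "(\<Prod>i\<in>T. b i) \<notin> P j"
        using P(4) T j by (intro prime_ideal_prod_notin P(1)) auto
      ultimately show ?thesis by blast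
    qed
  qed
  have fH: "f dvd H" unfolding H(1) by (simp add: dvd_smult)
  have "L i \<noteq> 0" if "i \<in> I" for i using L(1)[OF that] by auto
  then have "H \<noteq> 0" unfolding H(1) using f(1) c0 I by auto
  moreover have "\<not> IntD_unit H"
  proof
    assume "IntD_unit H"
    then have "H dvd 1" unfolding IntD_unit_def by (metis dvd_triv_left)
    then have "f dvd 1" using fH dvd_trans by blast
    then show False using f(1) by (simp add: irreducible_def)
  qed
  moreover have "IntD_unit g \<or> IntD_unit h" if gh: "g \<in> IntD" "h \<in> IntD" "H = g * h" for g h
  proof -
    have "prime_elem f" using f(1) by (rule field_poly_irreducible_imp_prime)
    then have "f dvd g \<or> f dvd h" using fH gh(3) by (metis prime_elem_dvd_mult_iff)
    then show ?thesis using key[OF gh] key[OF gh(2,1)] gh(3) by (metis mult.commute)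
  qed
  ultimately show ?thesis using H(2) unfolding IntD_irreducible_def by blast
qed

text \<open>The summand \<open>c * a ^ m\<close> of the value at \<open>a\<close> is already
  divisible by \<open>c\<close>; \<open>dvd\<close> handles the other one.\<close>

lemma interp_poly_quotient_in_IntD:
  assumes c: "c \<noteq> 0" and q: "\<And>a. poly q (to_fract a) = to_fract (q' a)"
    and dvd: "\<And>a. c dvd e * ((1 - a ^ m) * q' a)"
  shows "smult (1 / to_fract c) (interp_poly m e c * q) \<in> IntD"
  unfolding IntD_def
proof (intro CollectI allI)
  fix a
  obtain k where k: "e * ((1 - a ^ m) * q' a) = c * k" using dvd[of a] by (meson dvdE)
  have "to_fract (e * (1 - a ^ m) + c * a ^ m) * to_fract (q' a)
      = to_fract (e * ((1 - a ^ m) * q' a) + c * (a ^ m * q' a))"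
    by (simp only: to_fract_mult[symmetric]) (simp add: algebra_simps)
  also have "\<dots> = to_fract c * to_fract (k + a ^ m * q' a)"
    unfolding k by (simp only: to_fract_mult[symmetric] distrib_left)
  finally have "poly (smult (1 / to_fract c) (interp_poly m e c * q)) (to_fract a)
      = to_fract (k + a ^ m * q' a)"
    using c by (simp add: poly_interp_poly q del: to_fract_add to_fract_mult to_fract_diff)
  then show "poly (smult (1 / to_fract c) (interp_poly m e c * q)) (to_fract a) \<in> range to_fract"
    by (simp only: rangeI)
qed

section \<open>Construction of the factorizations\<close>

theorem theorem5p1:
  fixes n :: nat
  assumes "dedekind_domain TYPE('a::idom)"
    and "infinite {M :: 'a set. is_maximal_ideal M}"
    and "\<forall>M :: 'a set. is_maximal_ideal M \<longrightarrow> finite_index M"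
    and "n \<ge> 1"
  shows "\<exists>(H :: 'a fract poly) (G :: nat \<Rightarrow> 'a fract poly).
           H \<in> IntD \<and> IntD_irreducible H \<and>
           (\<forall>i\<in>{1..n+1}. G i \<in> IntD \<and> IntD_irreducible (G i)) \<and>
           [:0, 1:] * H = (\<Prod>i=1..n+1. G i)"
proof -
  note D = assms(1)
  \<comment> \<open>\<open>P 0\<close> plays the role of the ideal \<open>R\<close>; the indices
    from 1 to \<open>n\<close> give the other ideals.\<close>
  obtain P :: "nat \<Rightarrow> 'a set" where inj: "inj P" and P: "\<And>i. is_maximal_ideal (P i)"
    using infinite_countable_subset[OF assms(2)] by auto
  have Pij: "P i = P j \<longleftrightarrow> i = j" for i j using inj by (auto simp: inj_def)
  have prime: "is_prime_ideal (P i)" and ideal: "is_ideal (P i)" and P1: "1 \<notin> P i" for i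
    using P[of i] maximal_ideal_imp_prime ideal_eq_UNIV_iff by (auto simp: is_maximal_ideal_def)
  have ne: "P i \<noteq> {0}" for i
  proof
    assume "P i = {0}"
    then have "P i \<subseteq> P (Suc i)" using ideal_zero[OF ideal] by simp
    then have "P i = P (Suc i)" using P[of i] P[of "Suc i"] by (auto simp: is_maximal_ideal_def)
    with Pij show False by simp
  qed
  have "\<forall>i. \<exists>t. uniformizer (P i) t" using ex_uniformizer[OF D P ne] by blast
  then obtain t where t: "\<And>i. uniformizer (P i) (t i)" by metis
  then have tP: "t i \<in> P i" for i by (simp add: uniformizer_def)
  have approx: "\<exists>b\<in>J. \<forall>i\<in>{0..n}. (b \<in> P i \<longleftrightarrow> x i \<in> P i) \<and> (uniformizer (P i) (x i) \<longrightarrow> uniformizer (P i) b)"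
    if "is_ideal J" "\<And>i. i \<in> {0..n} \<Longrightarrow> x i \<in> J" for J x
    using that inj P by (intro ex_simultaneous_approximation) (auto intro: inj_on_subset)
  have UNIV: "is_ideal (UNIV :: 'a set)" by (simp add: is_ideal_def)

  have "\<exists>b. b \<in> P i \<and> (\<forall>j\<in>{1..n} - {i}. b \<notin> P j)" if i: "i \<in> {1..n}" for i
  proof -
    obtain b where b: "\<forall>j\<in>{0..n}. (b \<in> P j \<longleftrightarrow> (if j = i then t j else 1) \<in> P j)"
      using approx[OF UNIV, of "\<lambda>j. if j = i then t j else 1"] by blast
    have "b \<in> P i" using b i tP by simp
    moreover have "b \<notin> P j" if "j \<in> {1..n} - {i}" for j using bspec[OF b, of j] that P1 by simp
    ultimately show ?thesis by blast
  qed
  then obtain b where b: "\<And>i. i \<in> {1..n} \<Longrightarrow> b i \<in> P i"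
      "\<And>i j. i \<in> {1..n} \<Longrightarrow> j \<in> {1..n} \<Longrightarrow> i \<noteq> j \<Longrightarrow> b i \<notin> P j"
    by (metis Diff_iff singletonD)

  obtain c where c': "\<forall>i\<in>{0..n}. (c \<in> P i \<longleftrightarrow> (if i = 0 then 1 else t i) \<in> P i) \<and>
      (uniformizer (P i) (if i = 0 then 1 else t i) \<longrightarrow> uniformizer (P i) c)"
    using approx[OF UNIV, of "\<lambda>i. if i = 0 then 1 else t i"] by blast
  have c: "uniformizer (P i) c" if "i \<in> {1..n}" for i using bspec[OF c', of i] that t by simp
  have cR: "c \<notin> P 0" using bspec[OF c', of 0] P1 by simp
  have cP: "c \<in> P i" if "i \<in> {1..n}" for i using c[OF that] by (simp add: uniformizer_def)
  have c0: "c \<noteq> 0" using cR ideal_zero[OF ideal] by auto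

  \<comment> \<open>The colon ideal of \<open>(c)\<close> by the intersection of the
    \<open>P i\<close>. Membership of \<open>e\<close> in it will make the quotients by
    \<open>c\<close> integer-valued.\<close>
  define J where "J = {a. \<forall>q. (\<forall>i\<in>{1..n}. q \<in> P i) \<longrightarrow> c dvd a * q}"
  have J: "is_ideal J"
    unfolding is_ideal_def J_def by (auto simp: distrib_right mult.assoc)
  \<comment> \<open>The multiplier that shows \<open>c\<close> to be a uniformizer at
    \<open>P i\<close> works for all of \<open>P i\<close>, hence for the intersection.\<close>
  have "\<exists>s. s \<in> J \<and> s \<notin> P i" if "i \<in> {1..n}" for i
    using c[OF that] that unfolding J_def uniformizer_def by blast
  then obtain s where s: "\<And>i. i \<in> {1..n} \<Longrightarrow> s i \<in> J \<and> s i \<notin> P i" by metis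
  \<comment> \<open>At \<open>P 0\<close> both demands on \<open>e\<close> are met by
    \<open>c * t 0\<close>: it is a multiple of \<open>c\<close>, and the factor \<open>c\<close>
    outside \<open>P 0\<close> preserves uniformizers.\<close>
  have ctJ: "c * t 0 \<in> J" unfolding J_def by (simp add: mult.assoc)
  have ct: "uniformizer (P 0) (c * t 0)"
    using uniformizer_perturb[OF prime[of 0] t[of 0] cR, where I = "{}" and r = 0] by simp
  define x where "x i = (if i = 0 then c * t 0 else s i)" for i
  have "x i \<in> J" if "i \<in> {0..n}" for i
    using s[of i] ctJ that by (cases "i = 0") (auto simp: x_def)
  then obtain e where eJ: "e \<in> J" and e: "\<forall>i\<in>{0..n}. (e \<in> P i \<longleftrightarrow> x i \<in> P i) \<and>
      (uniformizer (P i) (x i) \<longrightarrow> uniformizer (P i) e)"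
    using approx[OF J] by blast
  have eR: "uniformizer (P 0) e" using bspec[OF e, of 0] ct by (simp add: x_def)
  have eP: "e \<notin> P i" if "i \<in> {1..n}" for i
    using bspec[OF e, of i] s[OF that] that by (simp add: x_def)

  have "\<exists>m>0. \<forall>Q\<in>P ` {1..n}. \<forall>a. a \<notin> Q \<longrightarrow> 1 - a ^ m \<in> Q"
    using prime P assms(3) by (intro finite_index_ex_common_exponent) auto
  then obtain m where m: "m > 0" and pow: "\<And>i a. i \<in> {1..n} \<Longrightarrow> a \<notin> P i \<Longrightarrow> 1 - a ^ m \<in> P i"
    by blast

  define f where "f = interp_poly m e c"
  define L where "L i = interp_poly 1 (b i) 1" for i
  define H where "H = smult (1 / to_fract c) (f * (\<Prod>i\<in>{1..n}. L i))"
  define G1 where "G1 = smult (1 / to_fract c) (f * [:0, 1:])"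
  have f: "irreducible f" "poly f 0 = to_fract e" "poly f 1 = to_fract c"
    using irreducible_interp_poly[OF D P ne, of 0 e c m] eR cR m
    by (auto simp: f_def poly_interp_poly_0 poly_interp_poly_1)
  have L: "irreducible (L i)" "poly (L i) 0 = to_fract (b i)" "poly (L i) 1 = 1" if "i \<in> {1..n}" for i
  proof -
    have "b i \<noteq> 1" using b(1)[OF that] P1 by metis
    then show "irreducible (L i)" "poly (L i) 0 = to_fract (b i)" "poly (L i) 1 = 1"
      by (simp_all add: L_def irreducible_linear_interp_poly poly_interp_poly_0 poly_interp_poly_1
          del: One_nat_def)
  qed

  text \<open>At \<open>a \<in> P i\<close> the factor \<open>L i\<close> (respectively \<open>x\<close>) lies in \<open>P i\<close>, and otherwise
    \<open>1 - a ^ m\<close> does.\<close>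
  have dvd: "c dvd e * ((1 - a ^ m) * q)" if "\<And>i. i \<in> {1..n} \<Longrightarrow> a \<in> P i \<Longrightarrow> q \<in> P i" for a q
  proof -
    have "(1 - a ^ m) * q \<in> P i" if i: "i \<in> {1..n}" for i
      using pow[OF i, of a] \<open>\<And>i. i \<in> {1..n} \<Longrightarrow> a \<in> P i \<Longrightarrow> q \<in> P i\<close>[OF i]
        ideal_mult_left[OF ideal] ideal_mult_right[OF ideal] by blast
    then show ?thesis using eJ by (auto simp: J_def)
  qed
  have "H \<in> IntD"
    unfolding H_def f_def
  proof (rule interp_poly_quotient_in_IntD[OF c0])
    show "poly (\<Prod>i\<in>{1..n}. L i) (to_fract a) = to_fract (\<Prod>i\<in>{1..n}. b i * (1 - a) + a)" for a
      unfolding poly_prod to_fract_prod L_def poly_interp_poly by simp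
    show "c dvd e * ((1 - a ^ m) * (\<Prod>i\<in>{1..n}. b i * (1 - a) + a))" for a
    proof (rule dvd)
      fix i assume i: "i \<in> {1..n}" "a \<in> P i"
      then have "b i * (1 - a) + a \<in> P i"
        using b(1) ideal_add[OF ideal] ideal_mult_right[OF ideal] by blast
      then show "(\<Prod>i\<in>{1..n}. b i * (1 - a) + a) \<in> P i"
        using i(1) ideal_mult_right[OF ideal] by (subst prod.remove[of _ i]) auto
    qed
  qed
  moreover have "IntD_irreducible H"
    by (rule IntD_irreducible_quotient[where I = "{1..n}" and L = L and b = b and P = P, OF _ c0 f])
       (use L prime cP eP b(2) H_def \<open>H \<in> IntD\<close> in auto)
  moreover have "G1 \<in> IntD"
    unfolding G1_def f_def
    by (rule interp_poly_quotient_in_IntD[OF c0, where q' = "\<lambda>a. a"]) (auto intro: dvd)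
  \<comment> \<open>The linear factor is \<open>x\<close>, with value 0 at 0; for one index the
    condition on distinct \<open>i\<close> and \<open>j\<close> is vacuous. The ideal used is
    \<open>P 1\<close>, available since \<open>n \<ge> 1\<close>.\<close>
  moreover have "IntD_irreducible G1"
  proof (rule IntD_irreducible_quotient[where I = "{1::nat}" and L = "\<lambda>_. [:0, 1:]" and b = "\<lambda>_. 0"
        and P = P, OF _ c0 f])
    show "irreducible [:0, 1 :: 'a fract:]" by (rule degree_1_irreducible) simp
    show "G1 = smult (1 / to_fract c) (f * (\<Prod>i\<in>{1::nat}. [:0, 1:]))" by (simp add: G1_def)
  qed (use prime cP[of 1] eP[of 1] \<open>n \<ge> 1\<close> \<open>G1 \<in> IntD\<close> in auto)
  moreover have LI: "L i \<in> IntD" for i unfolding IntD_def L_def using poly_interp_poly by blast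
  \<comment> \<open>\<open>L i\<close> itself takes the place of \<open>f\<close>, with denominator
    1; its value 1 at 1 excludes constant nonunit factors.\<close>
  moreover have Lirr: "IntD_irreducible (L i)" if "i \<in> {1..n}" for i
    by (rule IntD_irreducible_quotient[where I = "{}" and c = 1 and e = "b i" and f = "L i"])
       (use L[OF that] LI in auto)
  moreover have "IntD_irreducible (L (i - 1))" if "i \<in> {1..n+1}" "i \<noteq> 1" for i
    using that by (intro Lirr) auto
  \<comment> \<open>\<open>G1\<close> absorbs \<open>x\<close>, \<open>f\<close> and the denominator
    \<open>c\<close>; the linear factors follow, shifted by one index.\<close>
  moreover have "[:0, 1:] * H = (\<Prod>i=1..n+1. if i = 1 then G1 else L (i - 1))" (is "_ = ?prod")
  proof -
    have "?prod = G1 * (\<Prod>i=Suc 1..Suc n. if i = 1 then G1 else L (i - 1))"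
      by (simp add: prod.atLeast_Suc_atMost)
    also have "\<dots> = G1 * (\<Prod>i=1..n. L i)"
      unfolding prod.shift_bounds_cl_Suc_ivl by simp
    finally show ?thesis by (simp add: G1_def H_def mult_ac)
  qed
  ultimately show ?thesis
    by (intro exI[of _ H] exI[of _ "\<lambda>i. if i = 1 then G1 else L (i - 1)"]) simp
qed

end
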